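(* Let $\ell\geq 3$ be odd and let $r\geq k\geq 2$ be integers. Then $R_{r,k}(C_\ell)>\max\{2^{\frac{r-1}{k-1}},\ 2^{\lfloor r/k\rfloor-1}(\ell-1)\}$.
   Context: For integers $r\geq k\geq 1$, an $(r,k)$-colouring of a graph $G$ is a function $\varphi:E(G)\to\binom{[r]}{k}$, assigning to each edge a set of exactly $k$ colours from $[r]$. A subgraph $H\subseteq G$ is monochromatic if there is a colour $i$ with $i\in\varphi(e)$ for every $e\in E(H)$. The set-Ramsey number $R_{r,k}(H)$ of a graph $H$ is the smallest $n$ such that every $(r,k)$-colouring of $K_n$ contains a monochromatic copy of $H$. $C_\ell$ is the cycle of length $\ell$. *)

theory Defs
  imports Complex_Main "HOL-Library.FuncSet" "HOL-Library.Ramsey"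
begin

type_synonym 'a sgraph = "'a set \<times> 'a set set"

abbreviation vertices :: "'a sgraph \<Rightarrow> 'a set"
  where "vertices G \<equiv> fst G"

abbreviation edges :: "'a sgraph \<Rightarrow> 'a set set"
  where "edges G \<equiv> snd G"

definition simple_graph :: "'a sgraph \<Rightarrow> bool"
  where "simple_graph G \<longleftrightarrow> finite (vertices G) \<and> edges G \<subseteq> nsets (vertices G) 2"

definition complete_graph :: "nat \<Rightarrow> nat sgraph"
  where "complete_graph n = ({1..n}, nsets {1..n} 2)"

text \<open>This is the cycle of length \<open>l\<close> only for \<open>l \<ge> 3\<close>; for smaller \<open>l\<close> it degenerates
  (for instance, for \<open>l = 1\<close> it is not a simple graph).\<close>
definition cycle_graph :: "nat \<Rightarrow> nat sgraph"
  where "cycle_graph l = ({0..<l}, {{i, Suc i mod l} | i. i < l})"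

definition subgraph :: "'a sgraph \<Rightarrow> 'a sgraph \<Rightarrow> bool"
  where "subgraph H G \<longleftrightarrow>
    simple_graph H \<and> vertices H \<subseteq> vertices G \<and> edges H \<subseteq> edges G"

definition graph_isomorphic :: "'a sgraph \<Rightarrow> 'b sgraph \<Rightarrow> bool"
  where "graph_isomorphic G H \<longleftrightarrow>
    (\<exists>f. bij_betw f (vertices G) (vertices H) \<and> edges H = (\<lambda>e. f ` e) ` edges G)"

text \<open>The set of colours is \<open>{1..r}\<close>. Only the values of a colouring on the edges matter.\<close>
definition set_colouring :: "nat \<Rightarrow> nat \<Rightarrow> 'a sgraph \<Rightarrow> ('a set \<Rightarrow> nat set) \<Rightarrow> bool"
  where "set_colouring r k G \<phi> \<longleftrightarrow> \<phi> \<in> edges G \<rightarrow> nsets {1..r} k"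

definition monochromatic :: "nat \<Rightarrow> ('a set \<Rightarrow> nat set) \<Rightarrow> 'a sgraph \<Rightarrow> bool"
  where "monochromatic r \<phi> H \<longleftrightarrow> (\<exists>i\<in>{1..r}. \<forall>e\<in>edges H. i \<in> \<phi> e)"

text \<open>For \<open>r \<ge> k \<ge> 1\<close> and a simple graph \<open>H\<close> the minimum is attained by Ramsey's theorem:
  keep one colour of each edge.\<close>
definition set_ramsey_number :: "nat \<Rightarrow> nat \<Rightarrow> 'a sgraph \<Rightarrow> nat"
  where "set_ramsey_number r k H =
    (LEAST n. \<forall>\<phi>. set_colouring r k (complete_graph n) \<phi> \<longrightarrow>
      (\<exists>H'. subgraph H' (complete_graph n) \<and> graph_isomorphic H H' \<and> monochromatic r \<phi> H'))"

end

theory Submission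
  imports Defs
begin

text \<open>An odd cycle of length \<open>l\<close> is contained neither in a bipartite graph nor in a graph whose
  components have fewer than \<open>l\<close> vertices. A binary code of length \<open>r\<close> and minimum distance \<open>k\<close>
  gives a colouring with bipartite colour classes: offer to a pair of words the coordinates in which
  they differ. For the first bound, write \<open>r - 1 = q (k - 1) + s\<close> with \<open>0 \<le> s < k - 1\<close>.
  If \<open>s = 0\<close>, the \<open>2\<^sup>q\<close> words consisting of a parity bit and \<open>k - 1\<close> copies of \<open>q\<close> bits suffice.
  If \<open>s > 0\<close>, the exponent is not an integer, and one finds \<open>2\<^sup>q\<^sup>+\<^sup>1\<close> words
  of length \<open>q (k - 1) + 2\<close> for \<open>q \<ge> 2\<close>, by concatenating codes of distance 2 and 3. For
  \<open>q = 1\<close>, four words exist once \<open>3 k \<le> 2 r\<close>, and otherwise two words suffice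
  because \<open>2 powr (3/2) < 3\<close>.\<close>

section \<open>Colourings without monochromatic odd cycles\<close>

text \<open>\<open>LEAST\<close> has the property only if some number does. Ramsey's theorem for
  \<open>r\<close> colours supplies one, since a clique on \<open>card (vertices H)\<close> vertices
  contains a copy of \<open>H\<close>.\<close>

lemma set_ramsey_number_property:
  fixes H :: "nat sgraph"
  assumes H: "simple_graph H" and k: "1 \<le> k" and \<phi>: "set_colouring r k (complete_graph (set_ramsey_number r k H)) \<phi>"
  shows "\<exists>H'. subgraph H' (complete_graph (set_ramsey_number r k H)) \<and>
    graph_isomorphic H H' \<and> monochromatic r \<phi> H'"
proof -
  let ?P = "\<lambda>n. \<forall>\<phi>. set_colouring r k (complete_graph n) \<phi> \<longrightarrow>
      (\<exists>H'. subgraph H' (complete_graph n) \<and> graph_isomorphic H H' \<and> monochromatic r \<phi> H')"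
  have finH: "finite (vertices H)" and eH: "edges H \<subseteq> nsets (vertices H) 2"
    using H by (auto simp: simple_graph_def)
  define q where "q = card (vertices H)"
  obtain N :: nat where N: "partn_lst {..<N} (replicate r q) 2"
    using ramsey_full by blast
  have "?P N"
  proof (intro allI impI)
    fix \<phi> assume \<phi>: "set_colouring r k (complete_graph N) \<phi>"
    \<comment> \<open>\<open>partn_lst\<close> numbers vertices and colours from 0, whereas here
      both start from 1; hence \<open>Suc\<close> and \<open>- 1\<close>.\<close>
    define g where "g e = (SOME i. i \<in> \<phi> (Suc ` e)) - 1" for e
    have Suc_e: "Suc ` e \<in> nsets {1..N} 2" if "e \<in> nsets {..<N} 2" for e
      using that by (auto simp: nsets_def card_image)
    have g: "Suc (g e) \<in> \<phi> (Suc ` e)" "g e < r" if "e \<in> nsets {..<N} 2" for e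
    proof -
      have *: "\<phi> (Suc ` e) \<in> nsets {1..r} k"
        using \<phi> Suc_e[OF that] by (auto simp: set_colouring_def complete_graph_def)
      then have "\<phi> (Suc ` e) \<noteq> {}" using k by (auto simp: nsets_def)
      then have "(SOME i. i \<in> \<phi> (Suc ` e)) \<in> \<phi> (Suc ` e)" by (simp add: some_in_eq)
      moreover have "\<phi> (Suc ` e) \<subseteq> {1..r}" using * by (auto simp: nsets_def)
      ultimately have "(SOME i. i \<in> \<phi> (Suc ` e)) \<in> {1..r} \<inter> \<phi> (Suc ` e)" by blast
      then have "Suc (g e) = (SOME i. i \<in> \<phi> (Suc ` e))" "Suc (g e) \<le> r" by (auto simp: g_def)
      then show "Suc (g e) \<in> \<phi> (Suc ` e)" "g e < r"
        using \<open>(SOME i. i \<in> \<phi> (Suc ` e)) \<in> \<phi> (Suc ` e)\<close> by simp_all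
    qed
    then have "g \<in> nsets {..<N} 2 \<rightarrow> {..<length (replicate r q)}" by auto
    then obtain i where i: "i < r" and "Ramsey.monochromatic {..<N} q 2 g i"
      using N by (fastforce simp: partn_lst_def)
    then obtain K where K: "K \<in> nsets {..<N} q" and gK: "g ` nsets K 2 \<subseteq> {i}"
      by (auto simp: Ramsey.monochromatic_def)
    have finK: "finite K" and cK: "card K = q" and KN: "K \<subseteq> {..<N}"
      using K by (auto simp: nsets_def)
    obtain f where f: "bij_betw f (vertices H) K"
      using finite_same_card_bij[OF finH finK] cK q_def by auto
    define F where "F = Suc \<circ> f"
    have F: "bij_betw F (vertices H) (Suc ` K)"
      unfolding F_def by (rule bij_betw_trans[OF f]) (simp add: bij_betw_def)
    have fe: "f ` e \<in> nsets K 2" if "e \<in> edges H" for e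
    proof -
      have "e \<subseteq> vertices H" "card e = 2" "finite e" using that eH by (auto simp: nsets_def)
      then show ?thesis using f unfolding bij_betw_def nsets_def
        by (auto simp: card_image inj_on_subset)
    qed
    have Fe: "F ` e = Suc ` (f ` e)" for e by (auto simp: F_def)
    define H' where "H' = (Suc ` K, (\<lambda>e. F ` e) ` edges H)"
    have sub: "nsets K 2 \<subseteq> nsets {..<N} 2" by (rule nsets_mono[OF KN])
    have 1: "edges H' \<subseteq> nsets (Suc ` K) 2"
      using fe by (auto simp: H'_def Fe nsets_def card_image)
    have 2: "Suc ` K \<subseteq> {1..N}" using KN by auto
    have "subgraph H' (complete_graph N)"
      unfolding subgraph_def simple_graph_def complete_graph_def
      using 1 2 finK nsets_mono[OF 2, of 2] by (auto simp: H'_def)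
    moreover have "graph_isomorphic H H'"
      unfolding graph_isomorphic_def using F by (auto simp: H'_def)
    moreover have "Suc i \<in> \<phi> (F ` e)" if "e \<in> edges H" for e
    proof -
      have "g (f ` e) = i" using gK fe[OF that] by blast
      then show ?thesis using g(1)[of "f ` e"] sub fe[OF that] by (auto simp: Fe)
    qed
    then have "monochromatic r \<phi> H'"
      unfolding monochromatic_def using i by (intro bexI[of _ "Suc i"]) (auto simp: H'_def)
    ultimately show "\<exists>H'. subgraph H' (complete_graph N) \<and> graph_isomorphic H H' \<and> monochromatic r \<phi> H'"
      by blast
  qed
  then have "?P (set_ramsey_number r k H)"
    unfolding set_ramsey_number_def by (rule LeastI)
  then show ?thesis using \<phi> by blast
qed

section \<open>Relations whose colour classes contain no cycle of odd length
  \<open>l\<close>\<close>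

lemma simple_cycle_graph: "2 \<le> l \<Longrightarrow> simple_graph (cycle_graph l)"
proof -
  assume l: "2 \<le> l"
  have "i \<noteq> Suc i mod l" if "i < l" for i
    using that l by (cases "Suc i = l") auto
  then show ?thesis using l
    by (auto simp: simple_graph_def cycle_graph_def)
qed

text \<open>From 0 onwards \<open>b\<close> is determined by parity. As \<open>l - 1\<close> is
  even, the closing edge from \<open>l - 1\<close> to 0 joins equal values.\<close>

lemma odd_cycle_alternating:
  fixes b :: "nat \<Rightarrow> bool"
  assumes "odd l" and alt: "\<And>j. j < l \<Longrightarrow> b j \<noteq> b (Suc j mod l)"
  shows False
proof -
  have b: "b j = (b 0 = even j)" if "j < l" for j
    using that
  proof (induction j)
    case (Suc j)
    then show ?case using alt[of j] by auto
  qed simp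
  have "0 < l" using \<open>odd l\<close> by (rule odd_pos)
  then show False
    using b[of "l - 1"] alt[of "l - 1"] \<open>odd l\<close> by simp
qed

lemma cycle_constant:
  assumes const: "\<And>j. j < l \<Longrightarrow> c j = c (Suc j mod l)" and "j < l"
  shows "c j = c 0"
  using \<open>j < l\<close>
proof (induction j)
  case (Suc j)
  then show ?case using const[of j] by simp
qed simp

text \<open>\<open>E i u v\<close> means that colour \<open>i\<close> may be used on the pair;
  exactly \<open>k\<close> of the available colours are kept. Symmetry makes this independent of the
  order of the endpoints.\<close>

lemma set_colouring_from_relations:
  assumes many: "\<And>u v. u \<in> V \<Longrightarrow> v \<in> V \<Longrightarrow> u \<noteq> v \<Longrightarrow> k \<le> card {i \<in> {1..r}. E i u v}"
    and sym: "\<And>i u v. E i u v \<Longrightarrow> E i v u"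
  obtains \<phi> where "\<phi> \<in> nsets V 2 \<rightarrow> nsets {1..r} k" and "\<And>i u v. {u, v} \<in> nsets V 2 \<Longrightarrow> i \<in> \<phi> {u, v} \<Longrightarrow> E i u v"
proof -
  have "\<exists>S. S \<in> nsets {1..r} k \<and> (\<forall>i u v. e = {u, v} \<longrightarrow> i \<in> S \<longrightarrow> E i u v)"
    if e_in: "e \<in> nsets V 2" for e
  proof -
    obtain u v where e: "e = {u, v}" "u \<noteq> v" "u \<in> V" "v \<in> V"
      using nsets2_E[OF e_in] by metis
    obtain S where S: "S \<subseteq> {i \<in> {1..r}. E i u v}" "card S = k" "finite S"
      using obtain_subset_with_card_n[OF many[OF e(3,4,2)]] by blast
    then have "S \<in> nsets {1..r} k" by (auto simp: nsets_def)
    moreover have "E i x y" if "e = {x, y}" "i \<in> S" for i x y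
    proof -
      have "E i u v" using S(1) that(2) by auto
      then show ?thesis using that(1) sym[of i u v] by (auto simp: e(1) doubleton_eq_iff)
    qed
    ultimately show ?thesis by blast
  qed
  then obtain \<phi> where "\<And>e. e \<in> nsets V 2 \<Longrightarrow> \<phi> e \<in> nsets {1..r} k \<and> (\<forall>i u v. e = {u, v} \<longrightarrow> i \<in> \<phi> e \<longrightarrow> E i u v)"
    by metis
  then have "\<phi> \<in> nsets V 2 \<rightarrow> nsets {1..r} k" and
      "\<And>i u v. {u, v} \<in> nsets V 2 \<Longrightarrow> i \<in> \<phi> {u, v} \<Longrightarrow> E i u v"
    by blast+
  then show thesis by (rule that)
qed

text \<open>Both lower bounds reduce to this: \<open>b\<close> witnesses that a colour class is
  bipartite, while \<open>c\<close> is constant on its components and has fibres too small for the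
  cycle.\<close>

lemma set_ramsey_number_odd_cycle_gt:
  fixes E :: "nat \<Rightarrow> nat \<Rightarrow> nat \<Rightarrow> bool"
  assumes l: "3 \<le> l" "odd l" and k: "1 \<le> k"
    and many: "\<And>u v. u \<in> {1..N} \<Longrightarrow> v \<in> {1..N} \<Longrightarrow> u \<noteq> v \<Longrightarrow> k \<le> card {i \<in> {1..r}. E i u v}"
    and sym: "\<And>i u v. E i u v \<Longrightarrow> E i v u"
    and colour_class: "\<And>i. i \<in> {1..r} \<Longrightarrow>
      (\<exists>b :: nat \<Rightarrow> bool. \<forall>u v. E i u v \<longrightarrow> b u \<noteq> b v) \<or>
      (\<exists>c :: nat \<Rightarrow> nat. (\<forall>u v. E i u v \<longrightarrow> c u = c v) \<and> (\<forall>x. card {u \<in> {1..N}. c u = x} < l))"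
  shows "N < set_ramsey_number r k (cycle_graph l)"
proof (rule ccontr)
  let ?R = "set_ramsey_number r k (cycle_graph l)"
  assume "\<not> N < ?R"
  \<comment> \<open>The colouring built on \<open>{1..N}\<close> restricts to
    \<open>{1..?R}\<close>, where the Ramsey property applies.\<close>
  then have R: "{1..?R} \<subseteq> {1..N}" by auto
  obtain \<phi> where \<phi>: "\<phi> \<in> nsets {1..N} 2 \<rightarrow> nsets {1..r} k"
    and E: "\<And>i u v. {u, v} \<in> nsets {1..N} 2 \<Longrightarrow> i \<in> \<phi> {u, v} \<Longrightarrow> E i u v"
    by (rule set_colouring_from_relations[of "{1..N}" k r E]) (use many sym in auto)
  have "set_colouring r k (complete_graph ?R) \<phi>"
    using \<phi> nsets_mono[OF R, of 2] by (auto simp: set_colouring_def complete_graph_def)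
  then obtain H where H: "subgraph H (complete_graph ?R)" "graph_isomorphic (cycle_graph l) H"
      "monochromatic r \<phi> H"
    using set_ramsey_number_property[OF simple_cycle_graph, of l k r \<phi>] l(1) k by auto
  obtain f where f: "bij_betw f {0..<l} (vertices H)"
      and eH: "edges H = (\<lambda>e. f ` e) ` edges (cycle_graph l)"
    using H(2) by (auto simp: graph_isomorphic_def cycle_graph_def)
  obtain i where i: "i \<in> {1..r}" and mono: "\<And>e. e \<in> edges H \<Longrightarrow> i \<in> \<phi> e"
    using H(3) by (auto simp: monochromatic_def)
  have step: "E i (f j) (f (Suc j mod l))" if "j < l" for j
  proof -
    have e: "{f j, f (Suc j mod l)} \<in> edges H"
      unfolding eH using that by (auto simp: cycle_graph_def intro!: image_eqI[of _ _ "{j, Suc j mod l}"])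
    moreover have "edges H \<subseteq> nsets {1..N} 2"
      using H(1) nsets_mono[OF R, of 2] by (auto simp: subgraph_def complete_graph_def simp del: One_nat_def)
    ultimately have "{f j, f (Suc j mod l)} \<in> nsets {1..N} 2" by blast
    then show ?thesis using E mono[OF e] by blast
  qed
  from colour_class[OF i] show False
  proof (elim disjE exE conjE)
    fix b :: "nat \<Rightarrow> bool" assume "\<forall>u v. E i u v \<longrightarrow> b u \<noteq> b v"
    then show False using odd_cycle_alternating[OF l(2), of "b \<circ> f"] step by auto
  next
    fix c :: "nat \<Rightarrow> nat"
    assume c: "\<forall>u v. E i u v \<longrightarrow> c u = c v" and small: "\<forall>x. card {u \<in> {1..N}. c u = x} < l"
    have "c (f j) = c (f 0)" if "j < l" for j
      using cycle_constant[of l "c \<circ> f" j] step c that by auto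
    moreover have "f ` {0..<l} \<subseteq> {1..N}"
      using f H(1) R by (auto simp: bij_betw_def subgraph_def complete_graph_def)
    ultimately have "f ` {0..<l} \<subseteq> {u \<in> {1..N}. c u = c (f 0)}"
      unfolding image_subset_iff mem_Collect_eq by (metis atLeastLessThan_iff)
    then have "card (f ` {0..<l}) \<le> card {u \<in> {1..N}. c u = c (f 0)}"
      by (intro card_mono) auto
    moreover have "card (f ` {0..<l}) = l"
      using card_image[OF bij_betw_imp_inj_on[OF f]] by simp
    ultimately show False using small by (metis not_less)
  qed
qed

section \<open>Binary codes with prescribed minimum distance\<close>

text \<open>The code is given by an encoding of the messages in \<open>A\<close>, so that codes for
  the same messages can be concatenated. For \<open>d > 0\<close> distinct messages get distinct
  words.\<close>

definition has_code :: "'a set \<Rightarrow> nat \<Rightarrow> nat \<Rightarrow> bool"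
  where "has_code A r d \<longleftrightarrow> (\<exists>c :: 'a \<Rightarrow> nat \<Rightarrow> bool.
    \<forall>u\<in>A. \<forall>v\<in>A. u \<noteq> v \<longrightarrow> d \<le> card {i. i < r \<and> c u i \<noteq> c v i})"

section \<open>Lengthening, concatenating and repeating codes\<close>

lemma has_code_mono:
  fixes A :: "'a set"
  assumes "has_code A r d" and "r \<le> r'"
  shows "has_code A r' d"
proof -
  obtain c :: "'a \<Rightarrow> nat \<Rightarrow> bool" where c: "\<And>u v. u \<in> A \<Longrightarrow> v \<in> A \<Longrightarrow> u \<noteq> v \<Longrightarrow> d \<le> card {i. i < r \<and> c u i \<noteq> c v i}"
    using assms(1) unfolding has_code_def by blast
  have "card {i. i < r \<and> c u i \<noteq> c v i} \<le> card {i. i < r' \<and> c u i \<noteq> c v i}" for u v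
    using assms(2) by (intro card_mono) auto
  then show ?thesis unfolding has_code_def using c le_trans by blast
qed

text \<open>Distances add when the two words of each message are concatenated.\<close>

lemma has_code_add:
  fixes A :: "'a set"
  assumes "has_code A r d" and "has_code A r' d'"
  shows "has_code A (r + r') (d + d')"
proof -
  obtain c :: "'a \<Rightarrow> nat \<Rightarrow> bool" where c: "\<And>u v. u \<in> A \<Longrightarrow> v \<in> A \<Longrightarrow> u \<noteq> v \<Longrightarrow> d \<le> card {i. i < r \<and> c u i \<noteq> c v i}"
    using assms(1) unfolding has_code_def by blast
  obtain c' :: "'a \<Rightarrow> nat \<Rightarrow> bool" where c': "\<And>u v. u \<in> A \<Longrightarrow> v \<in> A \<Longrightarrow> u \<noteq> v \<Longrightarrow> d' \<le> card {i. i < r' \<and> c' u i \<noteq> c' v i}"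
    using assms(2) unfolding has_code_def by blast
  define e where "e u i = (if i < r then c u i else c' u (i - r))" for u i
  have "card {i. i < r + r' \<and> e u i \<noteq> e v i} =
      card {i. i < r \<and> c u i \<noteq> c v i} + card {i. i < r' \<and> c' u i \<noteq> c' v i}" for u v
  proof -
    have "{i. i < r + r' \<and> e u i \<noteq> e v i} =
        {i. i < r \<and> c u i \<noteq> c v i} \<union> (\<lambda>i. r + i) ` {i. i < r' \<and> c' u i \<noteq> c' v i}"
    proof (rule set_eqI)
      fix x
      show "x \<in> {i. i < r + r' \<and> e u i \<noteq> e v i} \<longleftrightarrow>
          x \<in> {i. i < r \<and> c u i \<noteq> c v i} \<union> (\<lambda>i. r + i) ` {i. i < r' \<and> c' u i \<noteq> c' v i}"
      proof (cases "x < r")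
        case False
        then obtain y where "x = r + y" by (metis le_Suc_ex not_less)
        then show ?thesis by (auto simp: e_def)
      qed (auto simp: e_def)
    qed
    also have "card \<dots> = card {i. i < r \<and> c u i \<noteq> c v i} + card ((\<lambda>i. r + i) ` {i. i < r' \<and> c' u i \<noteq> c' v i})"
      by (intro card_Un_disjoint) auto
    finally show ?thesis by (simp add: card_image)
  qed
  then have "\<forall>u\<in>A. \<forall>v\<in>A. u \<noteq> v \<longrightarrow> d + d' \<le> card {i. i < r + r' \<and> e u i \<noteq> e v i}"
    using c c' by (simp add: add_mono)
  then show ?thesis unfolding has_code_def by blast
qed

lemma has_code_replicate:
  assumes "has_code A r d"
  shows "has_code A (n * r) (n * d)"
proof (induction n)
  case 0
  show ?case by (simp add: has_code_def)
next
  case (Suc n)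
  show ?case using has_code_add[OF assms Suc] by simp
qed

section \<open>Codes of distance 1, 2 and 3\<close>

lemma has_code_Pow_1: "has_code (Pow {..<m}) m 1"
proof -
  have "1 \<le> card {i. i < m \<and> (i \<in> S) \<noteq> (i \<in> T)}" if "S \<subseteq> {..<m}" "T \<subseteq> {..<m}" "S \<noteq> T" for S T
  proof -
    have "{i. i < m \<and> (i \<in> S) \<noteq> (i \<in> T)} \<noteq> {}" using that by blast
    then show ?thesis by (simp add: Suc_le_eq card_gt_0_iff)
  qed
  then show ?thesis unfolding has_code_def
    by (intro exI[of _ "\<lambda>S i. i \<in> S"]) auto
qed

text \<open>One of the sets is the other with \<open>a\<close> inserted. Thus a parity bit detects a
  single difference.\<close>

lemma parity_differs:
  assumes "finite S" "finite T" and a: "\<And>i. (i \<in> S) \<noteq> (i \<in> T) \<longleftrightarrow> i = a"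
  shows "odd (card S) \<noteq> odd (card T)"
proof (cases "a \<in> S")
  case True
  then have "a \<notin> T" using a[of a] by simp
  have "S = insert a T"
  proof (rule set_eqI)
    show "x \<in> S \<longleftrightarrow> x \<in> insert a T" for x using a[of x] True by (cases "x = a") auto
  qed
  then show ?thesis using assms(2) \<open>a \<notin> T\<close> by simp
next
  case False
  have "T = insert a S"
  proof (rule set_eqI)
    show "x \<in> T \<longleftrightarrow> x \<in> insert a S" for x using a[of x] False by (cases "x = a") auto
  qed
  then show ?thesis using assms(1) False by simp
qed

text \<open>A parity bit is appended: it supplies the second difference when the messages differ in
  only one place.\<close>

lemma has_code_Pow_2: "has_code (Pow {..<m}) (m + 1) 2"
proof -
  define c :: "nat set \<Rightarrow> nat \<Rightarrow> bool" where "c S i = (if i < m then i \<in> S else odd (card S))" for S i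
  have "2 \<le> card {i. i < m + 1 \<and> c S i \<noteq> c T i}" if S: "S \<subseteq> {..<m}" and T: "T \<subseteq> {..<m}" and "S \<noteq> T" for S T
  proof -
    let ?D = "{i. i < m + 1 \<and> c S i \<noteq> c T i}"
    obtain a where a: "(a \<in> S) \<noteq> (a \<in> T)" using \<open>S \<noteq> T\<close> by blast
    then have am: "a < m" using S T by blast
    have "\<exists>b. b \<noteq> a \<and> b \<in> ?D"
    proof (cases "\<exists>b. b \<noteq> a \<and> (b \<in> S) \<noteq> (b \<in> T)")
      case True
      then obtain b where b: "b \<noteq> a" "(b \<in> S) \<noteq> (b \<in> T)" by blast
      then have "b < m" using S T by blast
      then show ?thesis using b by (intro exI[of _ b]) (auto simp: c_def)
    next
      case False
      then have "odd (card S) \<noteq> odd (card T)"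
        using a S T by (intro parity_differs[where a = a]) (auto intro: finite_subset)
      then show ?thesis using am by (intro exI[of _ m]) (auto simp: c_def)
    qed
    then obtain b where b: "b \<noteq> a" "b \<in> ?D" by blast
    moreover have "a \<in> ?D" using a am by (auto simp: c_def)
    ultimately have "card {a, b} \<le> card ?D" by (intro card_mono) auto
    then show ?thesis using b(1) by simp
  qed
  then show ?thesis unfolding has_code_def by (intro exI[of _ c]) auto
qed

text \<open>To the message we append the parity bit and the sums of each of the other bits with the
  last one. In the latter \<open>m - 1\<close> check bits, the columns of the generator matrix are the unit
  vectors and the all-ones vector; these are non-zero and, as \<open>m \<ge> 3\<close>, pairwise distinct.\<close>
lemma has_code_Pow_3:
  assumes m: "3 \<le> m"
  shows "has_code (Pow {..<m}) (2 * m) 3"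
proof -
  define c :: "nat set \<Rightarrow> nat \<Rightarrow> bool" where
    "c S i = (if i < m then i \<in> S else if i < 2 * m - 1 then (i - m \<in> S) \<noteq> (m - 1 \<in> S)
      else odd (card S))" for S i
  have "3 \<le> card {i. i < 2 * m \<and> c S i \<noteq> c T i}" if S: "S \<subseteq> {..<m}" and T: "T \<subseteq> {..<m}" and "S \<noteq> T" for S T
  proof -
    let ?D = "{i. i < 2 * m \<and> c S i \<noteq> c T i}"
    define d where "d i \<longleftrightarrow> (i \<in> S) \<noteq> (i \<in> T)" for i
    have dm: "i < m" if "d i" for i using that S T by (auto simp: d_def)
    have D1: "i \<in> ?D" if "d i" for i using that dm[OF that] by (auto simp: d_def c_def)
    \<comment> \<open>Check bit \<open>m + i\<close> is the sum of message bits \<open>i\<close> and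
      \<open>m - 1\<close>, so it differs when exactly one of them does.\<close>
    have D2: "m + i \<in> ?D" if "i < m - 1" "d i \<noteq> d (m - 1)" for i using that by (auto simp: d_def c_def)
    obtain a where a: "d a" using \<open>S \<noteq> T\<close> by (auto simp: d_def)
    have "\<exists>x y. x \<noteq> a \<and> y \<noteq> a \<and> x \<noteq> y \<and> x \<in> ?D \<and> y \<in> ?D"
    proof (cases "\<exists>b. b \<noteq> a \<and> d b")
      case False
      then have uniq: "d i \<longleftrightarrow> i = a" for i using a by blast
      then have "odd (card S) \<noteq> odd (card T)"
        using S T by (intro parity_differs[where a = a]) (auto intro: finite_subset simp: d_def)
      then have x: "2 * m - 1 \<in> ?D" using m by (auto simp: c_def)
      \<comment> \<open>A lone difference at \<open>a < m - 1\<close> flips the check bit of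
        \<open>a\<close>; at \<open>a = m - 1\<close> it flips all of them, and the first is
        taken.\<close>
      define j where "j = (if a < m - 1 then a else 0)"
      have "m + j \<in> ?D" using dm[OF a] m by (intro D2) (auto simp: j_def uniq)
      moreover have "m + j \<noteq> a" "2 * m - 1 \<noteq> a" "m + j \<noteq> 2 * m - 1"
        using dm[OF a] m by (auto simp: j_def)
      ultimately show ?thesis using x by blast
    next
      case True
      then obtain b where b: "b \<noteq> a" "d b" by blast
      show ?thesis
      proof (cases "\<exists>e. e \<noteq> a \<and> e \<noteq> b \<and> d e")
        case True
        then show ?thesis using b D1 by blast
      next
        case False
        then have uniq: "d i \<longleftrightarrow> i = a \<or> i = b" for i using a b by blast
        have "\<exists>j. j < m - 1 \<and> d j \<noteq> d (m - 1)"
        proof (cases "d (m - 1)")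
          case True
          \<comment> \<open>Only two positions differ and \<open>m - 1\<close> is one of them; as
            \<open>m \<ge> 3\<close>, positions 0 and 1 lie below it and cannot both differ.\<close>
          have "\<not> d 0 \<or> \<not> d 1" using True m b(1) unfolding uniq by auto
          then have "\<not> d (if d 0 then 1 else 0)" by simp
          then show ?thesis using True m by (intro exI[of _ "if d 0 then 1 else 0"]) auto
        next
          case False
          then have "a \<noteq> m - 1" using a by auto
          then show ?thesis using False a dm[OF a] by (intro exI[of _ a]) auto
        qed
        then obtain j where "j < m - 1" "d j \<noteq> d (m - 1)" by blast
        then have "m + j \<in> ?D" by (rule D2)
        moreover have "m + j \<noteq> a" "m + j \<noteq> b" using dm[OF a] dm[OF b(2)] by auto
        ultimately show ?thesis using b D1[OF b(2)] by blast
      qed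
    qed
    then obtain x y where xy: "x \<noteq> a" "y \<noteq> a" "x \<noteq> y" "x \<in> ?D" "y \<in> ?D" by blast
    then have "card {a, x, y} \<le> card ?D" using D1[OF a] by (intro card_mono) auto
    then show ?thesis using xy(1-3) by auto
  qed
  then show ?thesis unfolding has_code_def by (intro exI[of _ c]) auto
qed

section \<open>Codes of arbitrary distance\<close>

lemma has_code_Pow_copies:
  assumes "2 \<le> k"
  shows "has_code (Pow {..<m}) (m * (k - 1) + 1) k"
proof -
  have "has_code (Pow {..<m}) ((m + 1) + (k - 2) * m) (2 + (k - 2) * 1)"
    by (intro has_code_add has_code_Pow_2 has_code_replicate has_code_Pow_1)
  moreover have "(m + 1) + (k - 2) * m = m * (k - 1) + 1"
    using assms by (cases k; cases "k - 1") (auto simp: algebra_simps)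
  moreover have "2 + (k - 2) * 1 = k" using assms by simp
  ultimately show ?thesis by simp
qed

text \<open>Induction in steps of two: a parity code adds distance 2 at a cost of
  \<open>m + 1\<close> coordinates, within the allowed \<open>2 * (m - 1)\<close> because
  \<open>m \<ge> 3\<close>.\<close>

lemma has_code_Pow_between:
  assumes "3 \<le> m" and "2 \<le> k"
  shows "has_code (Pow {..<m}) ((m - 1) * (k - 1) + 2) k"
  using \<open>2 \<le> k\<close>
proof (induction k rule: less_induct)
  case (less k)
  consider "k = 2" | "k = 3" | "4 \<le> k" using less.prems by linarith
  then show ?case
  proof cases
    case 1
    then show ?thesis using has_code_Pow_2[of m] assms(1) by simp
  next
    case 2
    have *: "(m - 1) * (3 - 1) + 2 = 2 * m" using assms(1) by simp
    show ?thesis unfolding 2 * by (rule has_code_Pow_3[OF assms(1)])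
  next
    case 3
    have "has_code (Pow {..<m}) (((m - 1) * (k - 2 - 1) + 2) + (m + 1)) ((k - 2) + 2)"
      using 3 by (intro has_code_add has_code_Pow_2 less.IH) auto
    moreover have "((m - 1) * (k - 2 - 1) + 2) + (m + 1) \<le> (m - 1) * (k - 1) + 2"
    proof -
      obtain m' k' where "m = m' + 3" "k = k' + 4"
        using assms(1) 3 by (metis add.commute le_Suc_ex)
      then show ?thesis by (simp add: algebra_simps)
    qed
    ultimately have "has_code (Pow {..<m}) ((m - 1) * (k - 1) + 2) ((k - 2) + 2)"
      by (rule has_code_mono)
    moreover have "(k - 2) + 2 = k" using 3 by simp
    ultimately show ?thesis by simp
  qed
qed

lemma has_code_Pow_4_words:
  assumes "3 * k \<le> 2 * r"
  shows "has_code (Pow {..<2::nat}) r k"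
proof -
  have *: "has_code (Pow {..<2::nat}) 3 2" using has_code_Pow_2[of 2] by simp
  show ?thesis
  proof (cases "even k")
    case True
    then obtain j where "k = 2 * j" by auto
    then show ?thesis
      using has_code_replicate[OF *, of j] has_code_mono[of _ "j * 3" _ r] assms by (simp add: mult.commute)
  next
    case False
    then obtain j where j: "k = 2 * j + 1" by (rule oddE)
    \<comment> \<open>The two plain bits give the last unit of distance. For
      \<open>k = 2 * j + 1\<close> the hypothesis rounds up to
      \<open>3 * j + 2 \<le> r\<close>.\<close>
    have "has_code (Pow {..<2::nat}) (j * 3 + 2) (j * 2 + 1)"
      by (intro has_code_add has_code_replicate * has_code_Pow_1)
    then show ?thesis using has_code_mono[of _ "j * 3 + 2" _ r] assms j by (simp add: mult.commute)
  qed
qed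

lemma exists_code_of_size:
  assumes k: "2 \<le> k" and rk: "k \<le> r"
  shows "\<exists>m::nat. has_code (Pow {..<m}) r k \<and> nat \<lfloor>2 powr ((real r - 1) / (real k - 1))\<rfloor> \<le> 2 ^ m"
proof -
  define q where "q = (r - 1) div (k - 1)"
  define s where "s = (r - 1) mod (k - 1)"
  let ?x = "(real r - 1) / (real k - 1)"
  have r: "r = q * (k - 1) + s + 1"
    using k rk div_mult_mod_eq[of "r - 1" "k - 1"] by (simp add: q_def s_def)
  have s: "s < k - 1" using k by (simp add: s_def)
  have q: "1 \<le> q" using r s rk k by (cases q) auto
  have size: ?thesis if "has_code (Pow {..<m}) r k" "?x \<le> real m" for m :: nat
  proof -
    have "2 powr ?x \<le> 2 powr real m" using that(2) by simp
    then have "2 powr ?x \<le> 2 ^ m" by (simp add: powr_realpow)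
    then have "nat \<lfloor>2 powr ?x\<rfloor> \<le> 2 ^ m"
      by (metis (mono_tags) floor_mono floor_of_nat nat_int nat_mono of_nat_numeral of_nat_power)
    then show ?thesis using that(1) by blast
  qed
  \<comment> \<open>Hence \<open>?x\<close> is \<open>q\<close> plus the fraction
    \<open>s / (k - 1) < 1\<close>.\<close>
  have rr: "real r - 1 = real q * (real k - 1) + real s"
    using arg_cong[OF r, of real] k by (simp add: of_nat_diff)
  consider "s = 0" | "0 < s" "2 \<le> q" | "q = 1" "3 * k \<le> 2 * r" | "q = 1" "2 * r < 3 * k"
    using q by linarith
  then show ?thesis
  proof cases
    case 1
    have "has_code (Pow {..<q}) r k" using has_code_Pow_copies[OF k, of q] r 1 by simp
    moreover have "?x \<le> real q" using rr 1 k by (simp add: field_simps)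
    ultimately show ?thesis by (rule size)
  next
    case 2
    have "has_code (Pow {..<q + 1}) (q * (k - 1) + 2) k"
      using has_code_Pow_between[of "q + 1" k] 2 k by simp
    then have "has_code (Pow {..<q + 1}) r k"
      by (rule has_code_mono) (use r 2 in linarith)
    moreover have "?x \<le> real (q + 1)" using rr s k by (simp add: field_simps)
    ultimately show ?thesis by (rule size)
  next
    case 3
    have "?x \<le> real 2" using rr 3 s k by (simp add: field_simps)
    then show ?thesis using size has_code_Pow_4_words[OF 3(2)] by blast
  next
    case 4
    have "has_code (Pow {..<1::nat}) r k"
      by (rule has_code_mono[OF has_code_Pow_copies[OF k]]) (use rk k in simp)
    moreover have "nat \<lfloor>2 powr ?x\<rfloor> \<le> 2 ^ 1"
    proof -
      \<comment> \<open>By integrality \<open>2 * r < 3 * k\<close> gives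
        \<open>2 * (r - 1) \<le> 3 * (k - 1)\<close>. Below, squaring compares 8 with 9.\<close>
      have "?x \<le> 3 / 2" using 4 k by (simp add: field_simps)
      then have "2 powr ?x \<le> 2 powr (3 / 2 :: real)" by simp
      moreover have "(2 powr (3 / 2 :: real)) ^ 2 < (3 :: real) ^ 2"
        by (simp add: powr_power)
      then have "2 powr (3 / 2 :: real) < (3 :: real)" by (rule power_less_imp_less_base) simp
      ultimately have "\<lfloor>2 powr ?x\<rfloor> < 3" by linarith
      then have "\<lfloor>2 powr ?x\<rfloor> \<le> 2" by linarith
      then show ?thesis by (simp add: nat_le_iff)
    qed
    ultimately show ?thesis by blast
  qed
qed

section \<open>The two lower bounds\<close>

text \<open>Colour \<open>i\<close> joins words that differ in coordinate \<open>i - 1\<close>, and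
  the value of that coordinate is a bipartition of the class.\<close>

lemma set_ramsey_number_gt_code:
  fixes A :: "'a set"
  assumes l: "3 \<le> l" "odd l" and k: "1 \<le> k" and A: "has_code A r k" "finite A" "N \<le> card A"
  shows "N < set_ramsey_number r k (cycle_graph l)"
proof -
  obtain c :: "'a \<Rightarrow> nat \<Rightarrow> bool" where c: "\<And>u v. u \<in> A \<Longrightarrow> v \<in> A \<Longrightarrow> u \<noteq> v \<Longrightarrow> k \<le> card {i. i < r \<and> c u i \<noteq> c v i}"
    using A(1) unfolding has_code_def by blast
  obtain f where f: "inj_on f {1..N}" "f ` {1..N} \<subseteq> A"
    using card_le_inj[of "{1..N}" A] A(2,3) by auto
  show ?thesis
  proof (rule set_ramsey_number_odd_cycle_gt[OF l k, where E = "\<lambda>i u v. c (f u) (i - 1) \<noteq> c (f v) (i - 1)"])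
    fix u v assume uv: "u \<in> {1..N}" "v \<in> {1..N}" "u \<noteq> v"
    have "k \<le> card {i. i < r \<and> c (f u) i \<noteq> c (f v) i}"
      using uv f by (intro c) (auto dest: inj_onD)
    also have "\<dots> = card (Suc ` {i. i < r \<and> c (f u) i \<noteq> c (f v) i})"
      by (simp add: card_image)
    also have "\<dots> \<le> card {i \<in> {1..r}. c (f u) (i - 1) \<noteq> c (f v) (i - 1)}"
      by (intro card_mono) auto
    finally show "k \<le> \<dots>" .
  qed (auto intro!: exI[of _ "\<lambda>u. c (f u) (_ - 1)"])
qed

lemma bit_differs_below:
  fixes a b :: nat
  assumes "a < 2 ^ n" "b < 2 ^ n" "a \<noteq> b"
  obtains p where "p < n" "bit a p \<noteq> bit b p"
proof -
  have "take_bit n a \<noteq> take_bit n b"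
    using assms by (simp add: take_bit_nat_eq_self)
  then show thesis using that by (auto simp: bit_eq_iff bit_take_bit_iff)
qed

text \<open>Vertex \<open>u\<close> lies in block \<open>(u - 1) div (l - 1)\<close>. The colours form \<open>q\<close> groups of \<open>k\<close>: the
  last group is used inside the blocks, the \<open>p\<close>-th one between blocks whose indices differ in
  the \<open>p\<close>-th bit.\<close>
lemma set_ramsey_number_gt_blocks:
  assumes l: "3 \<le> l" "odd l" and k: "1 \<le> k" and q: "1 \<le> q" "q * k \<le> r"
  shows "2 ^ (q - 1) * (l - 1) < set_ramsey_number r k (cycle_graph l)"
proof -
  define a where "a u = (u - 1) div (l - 1)" for u :: nat
  \<comment> \<open>Colours beyond the \<open>q\<close> full groups, if any, also fall into the last
    branch and stay inside blocks.\<close>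
  define E where "E i u v \<longleftrightarrow>
    (if (i - 1) div k < q - 1 then bit (a u) ((i - 1) div k) \<noteq> bit (a v) ((i - 1) div k) else a u = a v)"
    for i u v
  let ?N = "2 ^ (q - 1) * (l - 1)"
  show ?thesis
  proof (rule set_ramsey_number_odd_cycle_gt[OF l k, where E = E])
    fix u v assume uv: "u \<in> {1..?N}" "v \<in> {1..?N}" "u \<noteq> v"
    have a: "a w < 2 ^ (q - 1)" if "w \<in> {1..?N}" for w
      unfolding a_def using that l by (intro less_mult_imp_div_less) auto
    have "\<exists>p<q. \<forall>i. (i - 1) div k = p \<longrightarrow> E i u v"
    proof (cases "a u = a v")
      case True
      then show ?thesis using q by (intro exI[of _ "q - 1"]) (auto simp: E_def)
    next
      case False
      then obtain p where "p < q - 1" "bit (a u) p \<noteq> bit (a v) p"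
        using bit_differs_below a uv by metis
      then show ?thesis by (intro exI[of _ p]) (auto simp: E_def)
    qed
    then obtain p where p: "p < q" "\<And>i. (i - 1) div k = p \<Longrightarrow> E i u v" by blast
    have "(p + 1) * k \<le> q * k" using p(1) by (intro mult_right_mono) auto
    then have "p * k + k \<le> r" using q(2) by simp
    \<comment> \<open>These are the \<open>k\<close> colours of group \<open>p\<close>; the shift by
      1 is due to colours starting from 1.\<close>
    then have "(\<lambda>j. p * k + j + 1) ` {..<k} \<subseteq> {i \<in> {1..r}. E i u v}"
      using k by (auto intro!: p(2))
    then have "card ((\<lambda>j. p * k + j + 1) ` {..<k}) \<le> card {i \<in> {1..r}. E i u v}"
      by (intro card_mono) auto
    then show "k \<le> card {i \<in> {1..r}. E i u v}" by (simp add: card_image inj_on_def)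
  next
    fix i u v assume "E i u v" then show "E i v u" by (auto simp: E_def split: if_splits)
  next
    fix i assume "i \<in> {1..r}"
    show "(\<exists>b :: nat \<Rightarrow> bool. \<forall>u v. E i u v \<longrightarrow> b u \<noteq> b v) \<or>
      (\<exists>c :: nat \<Rightarrow> nat. (\<forall>u v. E i u v \<longrightarrow> c u = c v) \<and> (\<forall>x. card {u \<in> {1..?N}. c u = x} < l))"
    proof (cases "(i - 1) div k < q - 1")
      case True
      then show ?thesis by (intro disjI1 exI[of _ "\<lambda>u. bit (a u) ((i - 1) div k)"]) (auto simp: E_def)
    next
      case False
      have "card {u \<in> {1..?N}. a u = x} < l" for x
      proof -
        \<comment> \<open>A block has at most \<open>l - 1\<close> vertices, one too few for the
          cycle.\<close>
        have "{u \<in> {1..?N}. a u = x} \<subseteq> (\<lambda>j. x * (l - 1) + j + 1) ` {..<l - 1}"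
        proof
          fix u assume u: "u \<in> {u \<in> {1..?N}. a u = x}"
          then have "u = x * (l - 1) + (u - 1) mod (l - 1) + 1"
            using div_mult_mod_eq[of "u - 1" "l - 1"] by (auto simp: a_def)
          moreover have "(u - 1) mod (l - 1) < l - 1" using l by simp
          ultimately show "u \<in> (\<lambda>j. x * (l - 1) + j + 1) ` {..<l - 1}" by blast
        qed
        then have "card {u \<in> {1..?N}. a u = x} \<le> card {..<l - 1}"
          by (rule surj_card_le[rotated]) simp
        then show ?thesis using l by simp
      qed
      then show ?thesis using False by (intro disjI2 exI[of _ a]) (auto simp: E_def)
    qed
  qed
qed

theorem theorem6p2:
  fixes l r k :: nat
  assumes "l \<ge> 3" and "odd l" and "k \<ge> 2" and "r \<ge> k"
  shows "real (set_ramsey_number r k (cycle_graph l)) >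
    max (2 powr ((real r - 1) / (real k - 1)))
        (2 ^ (nat \<lfloor>real r / real k\<rfloor> - 1) * (real l - 1))"
proof -
  let ?R = "set_ramsey_number r k (cycle_graph l)"
  have k: "1 \<le> k" using assms(3) by simp
  obtain m :: nat where m: "has_code (Pow {..<m}) r k" "nat \<lfloor>2 powr ((real r - 1) / (real k - 1))\<rfloor> \<le> 2 ^ m"
    using exists_code_of_size[OF assms(3,4)] by blast
  have "nat \<lfloor>2 powr ((real r - 1) / (real k - 1))\<rfloor> < ?R"
    by (rule set_ramsey_number_gt_code[OF assms(1,2) k m(1)]) (use m(2) in \<open>auto simp: card_Pow\<close>)
  \<comment> \<open>An integer above the floor of a real number is above the number itself.\<close>
  then have "2 powr ((real r - 1) / (real k - 1)) < real ?R"
    by linarith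
  moreover have "2 ^ (nat \<lfloor>real r / real k\<rfloor> - 1) * (real l - 1) < real ?R"
  proof -
    have "nat \<lfloor>real r / real k\<rfloor> = r div k" by (simp add: floor_divide_of_nat_eq)
    moreover have "1 \<le> r div k" using assms(4) k by (simp add: Suc_le_eq div_greater_zero_iff)
    then have "2 ^ (r div k - 1) * (l - 1) < ?R"
      by (intro set_ramsey_number_gt_blocks[OF assms(1,2) k]) auto
    then have "real (2 ^ (r div k - 1) * (l - 1)) < real ?R" by (simp only: of_nat_less_iff)
    ultimately show ?thesis using assms(1) by (simp add: of_nat_diff)
  qed
  ultimately show ?thesis by simp
qed

end
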